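(* Let $A$ be a set with decidable equality and $f\colon A\to A$ a bijection with finite support. Let $s$ be a list enumerating $\mathrm{supp}(f)$ without repetitions and $N=|\mathrm{supp}(f)|$. Then $R=\mathrm{cycles}_f(N,s,[])$ is a list of closed prefixes for $f$, and $\mathrm{fromFP}(\mathrm{toFP}^*(R))\,a=f\,a$ for all $a\in A$.
   Context: $\mathrm{supp}(f)=\{x\in A\mid f\,x\neq x\}$. The transposition $(x\ y)$ swaps $x,y$ and fixes everything else. $a:\rho$ denotes the sequence with first element $a$ followed by $\rho$; $\rho[c]$ denotes $\rho$ with $c$ appended at the end; $\mathrm{last}(\rho)$ is the last element. $\mathrm{toFP}(a,[])=[]$, $\mathrm{toFP}(a,b:\rho')=(a,b):\mathrm{toFP}(b,\rho')$. $\mathrm{fromFP}([])=\mathrm{id}$, $\mathrm{fromFP}((a,b):as')=(a\ b)\circ\mathrm{fromFP}(as')$ (right-hand function applied first). A non-empty sequence $\rho=[a_1,\ldots,a_n]$ is a prefix with head $a_0$ for $f$ if $a_0\in\mathrm{supp}(f)$, $f\,a_i=a_{i+1}$ for $0\le i<n$, and $a_0$ does not occur in $\rho$; it is closed if $f\,a_n=a_0$. Define $\mathrm{cycle}_f(0,a)=[f\,a]$ and $\mathrm{cycle}_f(n+1,a)=\rho$ if $f\,b=a$, and $=\rho[f\,b]$ otherwise, where $\rho=\mathrm{cycle}_f(n,a)$ and $b=\mathrm{last}(\rho)$. For a list $R$ of sequences let $\bigcup R$ be the set of elements occurring in them; define $\mathrm{cycles}_f(n,[],R)=R$ and $\mathrm{cycles}_f(n,a:as,R)=\mathrm{cycles}_f(n,as,R)$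 if $a\in\bigcup R$, and $=\mathrm{cycles}_f(n,as,(a:\mathrm{cycle}_f(n,a)):R)$ otherwise. A list $R$ of sequences is a list of closed prefixes for $f$ if each entry has the form $a:\rho$ with $\rho$ a closed prefix with head $a$ for $f$ and distinct entries have no element in common. For such $R$, $\mathrm{toFP}^*(R)$ is the concatenation, in list order, of $\mathrm{toFP}(a,\rho)$ over the entries $a:\rho$ of $R$. *)

theory Defs
  imports "HOL-Combinatorics.Transposition"
begin

definition supp :: "('a \<Rightarrow> 'a) \<Rightarrow> 'a set" where
  "supp f = {x. f x \<noteq> x}"

primrec toFP :: "'a \<Rightarrow> 'a list \<Rightarrow> ('a \<times> 'a) list" where
  "toFP a [] = []"
| "toFP a (b # \<rho>) = (a, b) # toFP b \<rho>"

fun fromFP :: "('a \<times> 'a) list \<Rightarrow> 'a \<Rightarrow> 'a" where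
  "fromFP [] = id"
| "fromFP ((a, b) # ps) = Transposition.transpose a b \<circ> fromFP ps"

text \<open>With \<open>\<rho> = [a\<^sub>1, \<dots>, a\<^sub>n]\<close> and head \<open>a = a\<^sub>0\<close>, the list \<open>a # \<rho>\<close> has \<open>a\<^sub>i\<close> at position \<open>i\<close>.\<close>

definition is_prefix :: "('a \<Rightarrow> 'a) \<Rightarrow> 'a \<Rightarrow> 'a list \<Rightarrow> bool" where
  "is_prefix f a \<rho> \<longleftrightarrow>
     \<rho> \<noteq> [] \<and> a \<in> supp f \<and>
     (\<forall>i < length \<rho>. f ((a # \<rho>) ! i) = (a # \<rho>) ! Suc i) \<and>
     a \<notin> set \<rho>"

definition is_closed_prefix :: "('a \<Rightarrow> 'a) \<Rightarrow> 'a \<Rightarrow> 'a list \<Rightarrow> bool" where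
  "is_closed_prefix f a \<rho> \<longleftrightarrow> is_prefix f a \<rho> \<and> f (last \<rho>) = a"

primrec cycle_from :: "('a \<Rightarrow> 'a) \<Rightarrow> nat \<Rightarrow> 'a \<Rightarrow> 'a list" where
  "cycle_from f 0 a = [f a]"
| "cycle_from f (Suc n) a =
     (let \<rho> = cycle_from f n a; b = last \<rho>
      in if f b = a then \<rho> else \<rho> @ [f b])"

primrec cycles_from :: "('a \<Rightarrow> 'a) \<Rightarrow> nat \<Rightarrow> 'a list \<Rightarrow> 'a list list \<Rightarrow> 'a list list" where
  "cycles_from f n [] R = R"
| "cycles_from f n (a # xs) R =
     (if a \<in> \<Union> (set ` set R) then cycles_from f n xs R
      else cycles_from f n xs ((a # cycle_from f n a) # R))"

text \<open>``Distinct entries'' means entries at distinct positions: a list in which the same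
  cycle is repeated is not a list of closed prefixes.\<close>

definition closed_prefix_list :: "('a \<Rightarrow> 'a) \<Rightarrow> 'a list list \<Rightarrow> bool" where
  "closed_prefix_list f R \<longleftrightarrow>
     (\<forall>\<sigma> \<in> set R. \<exists>a \<rho>. \<sigma> = a # \<rho> \<and> is_closed_prefix f a \<rho>) \<and>
     (\<forall>i < length R. \<forall>j < length R. i \<noteq> j \<longrightarrow> set (R ! i) \<inter> set (R ! j) = {})"

text \<open>The empty sequence is never an entry of a list of closed prefixes; its value is a dummy.\<close>

definition toFP_star :: "'a list list \<Rightarrow> ('a \<times> 'a) list" where
  "toFP_star R = concat (map (\<lambda>\<sigma>. case \<sigma> of [] \<Rightarrow> [] | a # \<rho> \<Rightarrow> toFP a \<rho>) R)"

end

theory Submission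
  imports Defs
begin

text \<open>
  In a prefix \<open>a # \<rho>\<close> for an injective \<open>f\<close> every entry is an iterate \<open>f\<^sup>i a\<close>; a repetition
  could be cancelled down to \<open>f\<^sup>k a = a\<close> with \<open>k > 0\<close>, which the condition \<open>a \<notin> set \<rho>\<close> forbids.
  So prefixes are repetition-free subsets of the support, and a cycle that has not closed after
  \<open>|supp f|\<close> steps would contain too many points. A closed prefix is mapped bijectively
  to itself by \<open>f\<close>, so a cycle that meets an older one has its head in it; this gives disjointness.
  The transpositions of one closed prefix compose to \<open>f\<close> on that prefix and to the identity
  elsewhere, and since the prefixes are disjoint and cover the support, their product is \<open>f\<close>.
\<close>

section \<open>Prefixes of an injective map\<close>

lemma is_prefix_nth:
  assumes "is_prefix f a \<rho>" "i \<le> length \<rho>"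
  shows "(a # \<rho>) ! i = (f ^^ i) a"
  using assms(2)
proof (induction i)
  case (Suc i)
  have "f ((a # \<rho>) ! i) = (a # \<rho>) ! Suc i"
    using assms(1) Suc.prems by (simp add: is_prefix_def)
  with Suc show ?case by simp
qed simp

lemma is_prefix_distinct:
  assumes "inj f" "is_prefix f a \<rho>"
  shows "distinct (a # \<rho>)"
proof -
  have False if "i < j" "j \<le> length \<rho>" "(a # \<rho>) ! i = (a # \<rho>) ! j" for i j
  proof -
    have "(f ^^ i) a = (f ^^ i) ((f ^^ (j - i)) a)"
      using that is_prefix_nth[OF assms(2)]
      by (metis add_diff_inverse_nat comp_apply funpow_add less_imp_le_nat not_less order_trans)
    then have "(f ^^ (j - i)) a = a"
      using inj_fn[OF assms(1)] by (metis injD)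
    moreover have "(a # \<rho>) ! (j - i) = (f ^^ (j - i)) a"
      using that by (intro is_prefix_nth[OF assms(2)]) auto
    \<comment> \<open>As \<open>0 < j - i\<close>, this position lies beyond the head, where
      \<open>a\<close> must not recur.\<close>
    moreover have "(a # \<rho>) ! (j - i) \<in> set \<rho>"
      using that by (simp add: nth_Cons')
    ultimately show False
      using assms(2) by (simp add: is_prefix_def)
  qed
  then show ?thesis
    unfolding distinct_conv_nth
    by (metis length_Cons less_Suc_eq_le linorder_neqE_nat)
qed

lemma is_prefix_subset_supp:
  assumes "inj f" "is_prefix f a \<rho>"
  shows "set (a # \<rho>) \<subseteq> supp f"
proof -
  have "(f ^^ i) a \<in> supp f" for i
  proof (induction i)
    case 0
    then show ?case using assms(2) by (simp add: is_prefix_def)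
  next
    case (Suc i)
    \<comment> \<open>The support is closed under \<open>f\<close>: \<open>f (f x) = f x\<close>
      would cancel to \<open>f x = x\<close>.\<close>
    then show ?case using assms(1) by (auto simp: supp_def dest: injD)
  qed
  then show ?thesis
    using is_prefix_nth[OF assms(2)]
    by (metis in_set_conv_nth length_Cons less_Suc_eq_le subsetI)
qed

section \<open>Growing a cycle until it closes\<close>

lemma is_prefix_append_image:
  assumes "is_prefix f a \<rho>" "f (last \<rho>) \<noteq> a"
  shows "is_prefix f a (\<rho> @ [f (last \<rho>)])"
  unfolding is_prefix_def
proof (intro conjI allI impI)
  have ne: "\<rho> \<noteq> []" using assms(1) by (simp add: is_prefix_def)
  fix i assume i: "i < length (\<rho> @ [f (last \<rho>)])"
  show "f ((a # \<rho> @ [f (last \<rho>)]) ! i) = (a # \<rho> @ [f (last \<rho>)]) ! Suc i"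
  proof (cases "i < length \<rho>")
    case True
    then have "f ((a # \<rho>) ! i) = (a # \<rho>) ! Suc i"
      using assms(1) by (auto simp: is_prefix_def)
    moreover have "(a # \<rho> @ [f (last \<rho>)]) ! i = (a # \<rho>) ! i"
      using True by (metis append_Cons length_Cons less_SucI nth_append)
    ultimately show ?thesis
      using True by (simp add: nth_append)
  next
    case False
    with i have "i = length \<rho>" by simp
    \<comment> \<open>The head shifts indices by one, so position \<open>length \<rho>\<close> holds
      \<open>last \<rho>\<close>.\<close>
    then show ?thesis
      using ne by (cases \<rho> rule: rev_cases) (auto simp: nth_append)
  qed
qed (use assms in \<open>auto simp: is_prefix_def\<close>)

lemma is_prefix_cycle_from:
  assumes "a \<in> supp f"
  shows "is_prefix f a (cycle_from f n a)"
proof (induction n)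
  case 0
  then show ?case using assms by (auto simp: is_prefix_def supp_def)
next
  case (Suc n)
  then show ?case by (auto simp: Let_def intro: is_prefix_append_image)
qed

text \<open>Once closed, the sequence never changes again. Being open after \<open>n\<close> steps
  therefore means that every step appended an element to the initial singleton.\<close>

lemma length_cycle_from:
  "f (last (cycle_from f n a)) \<noteq> a \<Longrightarrow> length (cycle_from f n a) = Suc n"
  by (induction n) (auto simp: Let_def split: if_splits)

lemma is_closed_prefix_cycle_from:
  assumes "inj f" "finite (supp f)" "card (supp f) \<le> n" "a \<in> supp f"
  shows "is_closed_prefix f a (cycle_from f n a)"
proof -
  let ?\<rho> = "cycle_from f n a"
  have p: "is_prefix f a ?\<rho>"
    using assms(4) by (rule is_prefix_cycle_from)
  \<comment> \<open>The head counts as well, so the cycle has length below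
    \<open>card (supp f) \<le> n\<close>, whereas an open one would have length
    \<open>Suc n\<close>.\<close>
  have "length (a # ?\<rho>) \<le> card (supp f)"
    using card_mono[OF assms(2) is_prefix_subset_supp[OF assms(1) p]]
      distinct_card[OF is_prefix_distinct[OF assms(1) p]] by simp
  then have "length ?\<rho> \<noteq> Suc n"
    using assms(3) by auto
  then show ?thesis
    using p length_cycle_from[of f n a] by (auto simp: is_closed_prefix_def)
qed

section \<open>Invariance and disjointness\<close>

lemma is_closed_prefix_image:
  assumes "is_closed_prefix f a \<rho>"
  shows "f ` set (a # \<rho>) = set (a # \<rho>)"
proof -
  have p: "\<And>i. i < length \<rho> \<Longrightarrow> f ((a # \<rho>) ! i) = \<rho> ! i" and ne: "\<rho> \<noteq> []"
    and l: "f (last \<rho>) = a"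
    using assms by (auto simp: is_closed_prefix_def is_prefix_def)
  \<comment> \<open>On a closed prefix \<open>f\<close> acts as rotation by one place.\<close>
  have "map f (a # \<rho>) = \<rho> @ [a]"
  proof (rule nth_equalityI)
    fix i assume "i < length (map f (a # \<rho>))"
    then consider "i < length \<rho>" | "i = length \<rho>" by fastforce
    then show "map f (a # \<rho>) ! i = (\<rho> @ [a]) ! i"
    proof cases
      case 1
      then show ?thesis
        using p[OF 1] by (simp add: nth_append del: list.map)
    next
      case 2
      then have "(a # \<rho>) ! i = last \<rho>"
        using ne by (simp add: last_conv_nth nth_Cons')
      then show ?thesis
        using 2 l by (simp add: nth_append del: list.map)
    qed
  qed simp
  then have "set (map f (a # \<rho>)) = set (\<rho> @ [a])" by (rule arg_cong)
  then show ?thesis by simp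
qed

text \<open>By injectivity the complement of an invariant set is closed under \<open>f\<close>, so
  the whole orbit of \<open>a\<close> avoids \<open>S\<close>. It is applied with \<open>S\<close>
  the union of the cycles already found.\<close>

lemma is_prefix_disjoint_invariant:
  assumes "inj f" "is_prefix f a \<rho>" "f ` S = S" "a \<notin> S"
  shows "set (a # \<rho>) \<inter> S = {}"
proof -
  have "(f ^^ i) a \<notin> S" for i
  proof (induction i)
    case (Suc i)
    then show ?case
      using assms(1,3) by (metis comp_apply funpow.simps(2) inj_image_mem_iff)
  qed (use assms(4) in simp)
  then show ?thesis
    using is_prefix_nth[OF assms(2)]
    by (metis disjoint_iff in_set_conv_nth length_Cons less_Suc_eq_le)
qed

lemma closed_prefix_list_Nil: "closed_prefix_list f []"
  by (simp add: closed_prefix_list_def)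

lemma closed_prefix_list_Cons:
  "closed_prefix_list f (\<sigma> # R) \<longleftrightarrow>
     (\<exists>a \<rho>. \<sigma> = a # \<rho> \<and> is_closed_prefix f a \<rho>) \<and>
     set \<sigma> \<inter> \<Union> (set ` set R) = {} \<and> closed_prefix_list f R"
proof -
  have "(\<forall>i < length (\<sigma> # R). \<forall>j < length (\<sigma> # R). i \<noteq> j \<longrightarrow>
            set ((\<sigma> # R) ! i) \<inter> set ((\<sigma> # R) ! j) = {}) \<longleftrightarrow>
        (\<forall>j < length R. set \<sigma> \<inter> set (R ! j) = {}) \<and>
        (\<forall>i < length R. \<forall>j < length R. i \<noteq> j \<longrightarrow> set (R ! i) \<inter> set (R ! j) = {})"
    \<comment> \<open>Index 0 is split off both quantifiers; the two mixed cases agree by symmetry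
      of intersection.\<close>
    by (simp add: All_less_Suc2 Int_commute[of _ "set \<sigma>"] conj_commute imp_conjR
        all_conj_distrib)
  also have "(\<forall>j < length R. set \<sigma> \<inter> set (R ! j) = {}) \<longleftrightarrow> set \<sigma> \<inter> \<Union> (set ` set R) = {}"
    unfolding all_set_conv_all_nth[of R "\<lambda>\<tau>. set \<sigma> \<inter> set \<tau> = {}", symmetric] by blast
  finally show ?thesis
    unfolding closed_prefix_list_def by (simp add: conj_ac)
qed

lemma closed_prefix_list_image:
  assumes "closed_prefix_list f R"
  shows "f ` \<Union> (set ` set R) = \<Union> (set ` set R)"
proof -
  have "f ` set \<sigma> = set \<sigma>" if "\<sigma> \<in> set R" for \<sigma>
    using that assms is_closed_prefix_image unfolding closed_prefix_list_def by metis
  then show ?thesis by (simp add: image_UN)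
qed

lemma cycles_from_closed_and_covering:
  assumes "inj f" "finite (supp f)" "card (supp f) \<le> n"
    and "set xs \<subseteq> supp f" "closed_prefix_list f R"
  shows "closed_prefix_list f (cycles_from f n xs R) \<and>
    set xs \<union> \<Union> (set ` set R) \<subseteq> \<Union> (set ` set (cycles_from f n xs R))"
  using assms(4,5)
proof (induction xs arbitrary: R)
  case (Cons a xs)
  show ?case
  proof (cases "a \<in> \<Union> (set ` set R)")
    case True
    then show ?thesis using Cons.IH[of R] Cons.prems by auto
  next
    case False
    have c: "is_closed_prefix f a (cycle_from f n a)"
      using assms Cons.prems by (intro is_closed_prefix_cycle_from) auto
    moreover have "set (a # cycle_from f n a) \<inter> \<Union> (set ` set R) = {}"
      using c False closed_prefix_list_image[OF Cons.prems(2)]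
      by (intro is_prefix_disjoint_invariant[OF assms(1)]) (auto simp: is_closed_prefix_def)
    ultimately have "closed_prefix_list f ((a # cycle_from f n a) # R)"
      using Cons.prems(2) by (simp add: closed_prefix_list_Cons)
    from Cons.IH[OF _ this] Cons.prems(1) False show ?thesis by auto
  qed
qed simp

section \<open>Products of transpositions\<close>

lemma fromFP_append: "fromFP (ps @ qs) = fromFP ps \<circ> fromFP qs"
  by (induction ps rule: fromFP.induct) (auto simp: comp_assoc)

lemma fromFP_toFP_notin: "x \<notin> set (a # \<rho>) \<Longrightarrow> fromFP (toFP a \<rho>) x = x"
  by (induction \<rho> arbitrary: a) auto

text \<open>The rightmost transposition acts first, so the last element is carried back one place by
  each factor until it reaches the head.\<close>

lemma fromFP_toFP_last: "fromFP (toFP a \<rho>) (last (a # \<rho>)) = a"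
  by (induction \<rho> arbitrary: a) auto

text \<open>Factors further right do not involve the element at position \<open>i\<close>; its own
  factor moves it one place on, and by distinctness no factor further left touches the
  result.\<close>

lemma fromFP_toFP_nth:
  "distinct (a # \<rho>) \<Longrightarrow> i < length \<rho> \<Longrightarrow> fromFP (toFP a \<rho>) ((a # \<rho>) ! i) = \<rho> ! i"
proof (induction \<rho> arbitrary: a i)
  case (Cons b \<rho>)
  show ?case
  proof (cases i)
    case 0
    then show ?thesis using Cons.prems by (simp add: fromFP_toFP_notin)
  next
    case (Suc j)
    then have j: "j < length \<rho>" using Cons.prems by simp
    then have "fromFP (toFP b \<rho>) ((b # \<rho>) ! j) = \<rho> ! j"
      using Cons.IH Cons.prems by simp
    moreover have "\<rho> ! j \<noteq> a" "\<rho> ! j \<noteq> b"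
      using j Cons.prems(1) nth_mem by fastforce+
    ultimately show ?thesis using Suc by simp
  qed
qed simp

lemma fromFP_toFP_closed_prefix:
  assumes "inj f" "is_closed_prefix f a \<rho>" "x \<in> set (a # \<rho>)"
  shows "fromFP (toFP a \<rho>) x = f x"
proof -
  have p: "is_prefix f a \<rho>" and l: "f (last \<rho>) = a" and ne: "\<rho> \<noteq> []"
    using assms(2) by (auto simp: is_closed_prefix_def is_prefix_def)
  obtain i where i: "i \<le> length \<rho>" "x = (a # \<rho>) ! i"
    using assms(3) by (metis in_set_conv_nth length_Cons less_Suc_eq_le)
  show ?thesis
  proof (cases "i = length \<rho>")
    case True
    then have "x = last \<rho>"
      using i(2) ne by (simp add: last_conv_nth nth_Cons')
    then show ?thesis
      using fromFP_toFP_last[of a \<rho>] l ne by simp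
  next
    case False
    then have "i < length \<rho>" using i(1) by simp
    then show ?thesis
      using fromFP_toFP_nth[OF is_prefix_distinct[OF assms(1) p]] p i(2)
      by (auto simp: is_prefix_def)
  qed
qed

lemma fromFP_toFP_star:
  assumes "inj f" "closed_prefix_list f R"
  shows "fromFP (toFP_star R) x = (if x \<in> \<Union> (set ` set R) then f x else x)"
  using assms(2)
proof (induction R)
  case Nil
  then show ?case by (simp add: toFP_star_def)
next
  case (Cons \<sigma> R)
  then obtain a \<rho> where \<sigma>: "\<sigma> = a # \<rho>" "is_closed_prefix f a \<rho>"
    and disj: "set (a # \<rho>) \<inter> \<Union> (set ` set R) = {}" and R: "closed_prefix_list f R"
    by (auto simp: closed_prefix_list_Cons)
  have eq: "fromFP (toFP_star (\<sigma> # R)) x = fromFP (toFP a \<rho>) (fromFP (toFP_star R) x)"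
    using \<sigma>(1) by (simp add: toFP_star_def fromFP_append)
  show ?case
  proof (cases "x \<in> \<Union> (set ` set R)")
    case True
    \<comment> \<open>The factors from \<open>R\<close> act first and keep the point inside their
      invariant union, which the factors from \<open>\<sigma>\<close> fix pointwise.\<close>
    then have "f x \<in> \<Union> (set ` set R)"
      using closed_prefix_list_image[OF R] by blast
    then have "f x \<notin> set (a # \<rho>)" using disj by blast
    then show ?thesis
      using eq True Cons.IH[OF R] by (simp add: fromFP_toFP_notin)
  next
    case False
    then have "fromFP (toFP_star (\<sigma> # R)) x = fromFP (toFP a \<rho>) x"
      using eq Cons.IH[OF R] by simp
    then show ?thesis
      using False \<sigma>(1) fromFP_toFP_closed_prefix[OF assms(1) \<sigma>(2)] fromFP_toFP_notin[of x a \<rho>]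
      by (cases "x \<in> set (a # \<rho>)") auto
  qed
qed

theorem theorem1:
  fixes f :: "'a \<Rightarrow> 'a" and s :: "'a list" and N :: nat and R :: "'a list list"
  assumes "bij f"
    and "finite (supp f)"
    and "set s = supp f" and "distinct s"
    and "N = card (supp f)"
    and "R = cycles_from f N s []"
  shows "closed_prefix_list f R \<and> (\<forall>a. fromFP (toFP_star R) a = f a)"
proof -
  have inj: "inj f" using assms(1) by (rule bij_is_inj)
  have R: "closed_prefix_list f R" and cover: "supp f \<subseteq> \<Union> (set ` set R)"
    using cycles_from_closed_and_covering[OF inj assms(2), of N s "[]"] assms(3,5,6)
    by (auto simp: closed_prefix_list_Nil)
  have "fromFP (toFP_star R) a = f a" for a
  proof (cases "a \<in> \<Union> (set ` set R)")
    case False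
    \<comment> \<open>Uncovered points lie outside the support, so both sides fix them.\<close>
    then have "f a = a" using cover unfolding supp_def by blast
    with False show ?thesis using fromFP_toFP_star[OF inj R, of a] by simp
  qed (simp add: fromFP_toFP_star[OF inj R])
  with R show ?thesis by blast
qed

end
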